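(* Let $x$ and $k$ be indeterminates and let $A_n^{(k)}(x)$, $n\ge 0$, be the $1/k$-Eulerian polynomials. Then, as formal power series in $z$, the ordinary generating function $\sum_{n\ge 0}A_n^{(k)}(x)z^n$ equals the continued fraction $$\cfrac{1}{1-\cfrac{z}{1-\cfrac{kxz}{1-\cfrac{(k+1)z}{1-\cfrac{2kxz}{1-\cfrac{(2k+1)z}{1-\cfrac{3kxz}{1-\cfrac{(3k+1)z}{1-\cdots}}}}}}}}$$ (the successive partial numerators being $c_1z,c_2z,\ldots$ with $c_{2i-1}=(i-1)k+1$ and $c_{2i}=ikx$ for $i\ge 1$), and equivalently equals $$\cfrac{1}{1-z-\cfrac{kxz^2}{1-(kx+k+1)z-\cfrac{2kx(k+1)z^2}{1-(2kx+2k+1)z-\cfrac{3kx(2k+1)z^2}{1-(3kx+3k+1)z-\cdots}}}}$$ (that is, $1/(1-\alpha_0z-\beta_1z^2/(1-\alpha_1z-\beta_2z^2/(1-\cdots)))$ with $\alpha_i=ikx+ik+1$ for $i\ge0$ and $\beta_i=ikx((i-1)k+1)$ for $i\ge 1$).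
   Context: The Savage-Viswanathan polynomials $F_n(x,y)$ are defined by the exponential generating function $\sum_{n\ge 0}F_n(x,y)\frac{z^n}{n!}=\left(\frac{1-x}{e^{z(x-1)}-x}\right)^y$ (a formal power series in $z$; the base has constant term $1$, and $u^y=\exp(y\ln u)$). They are polynomials in $x,y$. The $1/k$-Eulerian polynomials are $A_n^{(k)}(x)=k^nF_n(x,1/k)$. An infinite continued fraction denotes the limit, in the $z$-adic (coefficientwise) topology on formal power series, of its finite truncations. *)

theory Defs
  imports "HOL-Computational_Algebra.Computational_Algebra"
begin

text \<open>
  The type \<^typ>\<open>rat poly poly fract\<close> is the field of rational functions in two
  indeterminates over the rationals. The inner indeterminate is always \<open>x\<close>; the outer one
  is \<open>y\<close> where the Savage-Viswanathan polynomials are introduced, and \<open>k\<close> in the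
  \<open>1/k\<close>-Eulerian polynomials.
\<close>

definition inner_var :: "rat poly poly fract"
  where "inner_var = to_fract [:[:0, 1:]:]"

definition outer_var :: "rat poly poly fract"
  where "outer_var = to_fract [:0, 1:]"


subsection \<open>Savage-Viswanathan polynomials\<close>

text \<open>\<open>u\<^sup>y = exp (y ln u)\<close>, meant for series \<open>u\<close> with constant term \<open>1\<close>;
  note that \<^term>\<open>fps_ln 1\<close> is the series of \<open>ln (1 + z)\<close>.\<close>

definition fps_pow :: "'a::field_char_0 fps \<Rightarrow> 'a \<Rightarrow> 'a fps"
  where "fps_pow u y = fps_exp y oo (fps_ln 1 oo (u - 1))"

definition sv_base :: "'a::field_char_0 \<Rightarrow> 'a fps"
  where "sv_base x = fps_const (1 - x) / (fps_exp (x - 1) - fps_const x)"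

text \<open>\<open>F\<^sub>n\<close> is the polynomial in \<open>x\<close> and \<open>y\<close> whose image in the field of rational
  functions is \<open>n!\<close> times the coefficient of \<open>z\<^sup>n\<close>. That it exists is
  \<open>savage_viswanathan_egf\<close> below.\<close>

definition savage_viswanathan :: "nat \<Rightarrow> rat poly poly"
  where "savage_viswanathan n =
    (THE F. to_fract F = fact n * fps_nth (fps_pow (sv_base inner_var) outer_var) n)"

lemma inner_var_neq_1: "inner_var \<noteq> 1"
  unfolding inner_var_def to_fract_1[symmetric] to_fract_eq_iff by (simp add: one_pCons)

lemma sv_base_nth_0: "x \<noteq> 1 \<Longrightarrow> sv_base x $ 0 = 1"
  by (simp add: sv_base_def)

lemma sv_base_deriv:
  fixes x :: "'a::field_char_0"
  assumes "x \<noteq> 1"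
  shows "fps_deriv (sv_base x) =
    sv_base x * (fps_const (1 - x) + fps_const x * sv_base x)"
proof -
  define D where "D = fps_exp (x - 1) - fps_const x"
  have D0: "D $ 0 \<noteq> 0" using assms by (simp add: D_def)
  hence "D \<noteq> 0" by (metis fps_zero_nth)
  have uD: "sv_base x * D = fps_const (1 - x)"
    using D0 by (simp add: sv_base_def D_def[symmetric] fps_divide_unit mult.assoc
        inverse_mult_eq_1)
  have D': "fps_deriv D = fps_const (x - 1) * (D + fps_const x)"
    by (simp add: D_def)
  have "fps_deriv (sv_base x) * D + sv_base x * fps_deriv D = 0"
    using arg_cong[OF uD, of fps_deriv] by (simp add: algebra_simps)
  hence "fps_deriv (sv_base x) * D = sv_base x * (fps_const (1 - x) * (D + fps_const x))"
    unfolding D' by (simp add: algebra_simps fps_const_sub[symmetric] del: fps_const_sub)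
  also have "\<dots> = (sv_base x * (fps_const (1 - x) + fps_const x * sv_base x)) * D"
    unfolding uD[symmetric] by (simp add: algebra_simps)
  finally show ?thesis using \<open>D \<noteq> 0\<close> by simp
qed

lemma fps_pow_nth_0: "u $ 0 = 1 \<Longrightarrow> fps_pow u y $ 0 = 1"
  by (simp add: fps_pow_def)

lemma fps_pow_deriv:
  fixes u :: "'a::field_char_0 fps"
  assumes "u $ 0 = 1"
  shows "fps_deriv (fps_pow u y) * u = fps_const y * fps_pow u y * fps_deriv u"
proof -
  have c: "inverse (1 + fps_X) oo (u - 1) = inverse u"
    using assms by (simp add: fps_inverse_compose fps_compose_add_distrib)
  have "fps_deriv (fps_ln 1 oo (u - 1)) = inverse u * fps_deriv u"
    using assms by (simp add: fps_compose_deriv fps_ln_deriv c)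
  hence d: "fps_deriv (fps_pow u y) =
      fps_const y * fps_pow u y * (inverse u * fps_deriv u)"
    unfolding fps_pow_def
    by (subst fps_compose_deriv)
      (simp_all only: fps_exp_deriv fps_const_mult_apply_left fps_compose_nth_0 fps_ln_0)
  have "inverse u * u = 1" using assms by (intro inverse_mult_eq_1) simp
  have "fps_deriv (fps_pow u y) * u =
      fps_const y * fps_pow u y * fps_deriv u * (inverse u * u)"
    unfolding d by (simp only: mult_ac)
  thus ?thesis by (simp only: \<open>inverse u * u = 1\<close> mult_1_right)
qed

lemma sv_egf_deriv:
  fixes x y :: "'a::field_char_0"
  assumes "x \<noteq> 1"
  defines "G \<equiv> fps_pow (sv_base x) y"
  shows "fps_deriv G =
    fps_const y * G * (fps_const (1 - x) + fps_const x * sv_base x)"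
proof -
  have u0: "sv_base x $ 0 = 1" using assms(1) by (rule sv_base_nth_0)
  hence "sv_base x \<noteq> 0" by (metis fps_zero_nth zero_neq_one)
  moreover have "fps_deriv G * sv_base x =
      (fps_const y * G * (fps_const (1 - x) + fps_const x * sv_base x)) * sv_base x"
    using fps_pow_deriv[OF u0, of y] sv_base_deriv[OF assms(1)]
    by (simp add: G_def algebra_simps)
  ultimately show ?thesis by simp
qed

lemma to_fract_of_nat: "to_fract (of_nat n) = of_nat n"
  by (induction n) simp_all

lemma fact_fps_nth_Suc_in_subring:
  fixes f g h :: "'a::field_char_0 fps" and R :: "'a set"
  assumes R: "\<And>a b. a \<in> R \<Longrightarrow> b \<in> R \<Longrightarrow> a + b \<in> R"
             "\<And>a b. a \<in> R \<Longrightarrow> b \<in> R \<Longrightarrow> a * b \<in> R"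
             "\<And>n. of_nat n \<in> R"
    and y: "y \<in> R"
    and deriv: "fps_deriv f = fps_const y * f * h"
    and f: "\<And>i. i \<le> n \<Longrightarrow> fact i * f $ i \<in> R"
    and h: "\<And>i. i \<le> n \<Longrightarrow> fact i * h $ i \<in> R"
  shows "fact (Suc n) * f $ Suc n \<in> R"
proof -
  have "fps_deriv f $ n = y * (f * h) $ n"
    unfolding deriv by (simp add: mult.assoc)
  hence "of_nat (Suc n) * f $ Suc n = y * (\<Sum>i=0..n. f $ i * h $ (n - i))"
    by (simp add: fps_mult_nth del: of_nat_Suc)
  hence "fact (Suc n) * f $ Suc n = y * (\<Sum>i=0..n. fact n * (f $ i * h $ (n - i)))"
    by (simp add: fact_Suc mult_ac sum_distrib_left[symmetric] del: of_nat_Suc)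
  also have "(\<Sum>i=0..n. fact n * (f $ i * h $ (n - i))) =
      (\<Sum>i=0..n. of_nat (n choose i) * ((fact i * f $ i) * (fact (n - i) * h $ (n - i))))"
    by (intro sum.cong) (auto simp: binomial_fact field_simps)
  finally have eq: "fact (Suc n) * f $ Suc n = y * \<dots>" .
  have zero: "0 \<in> R" using R(3)[of 0] by simp
  have sum: "sum g S \<in> R" if "\<And>i. i \<in> S \<Longrightarrow> g i \<in> R" "finite S"
    for g and S :: "nat set"
    using that(2,1) by induction (auto intro: R(1) zero)
  show ?thesis
    unfolding eq
    by (rule R(2)[OF y sum]) (auto intro!: R(2)[OF R(3) R(2)[OF f h]])
qed

lemma savage_viswanathan_egf:
  "to_fract (savage_viswanathan n) =
     fact n * fps_nth (fps_pow (sv_base inner_var) outer_var) n"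
proof -
  define R where "R = range (to_fract :: rat poly poly \<Rightarrow> _)"
  have R: "a + b \<in> R" "a * b \<in> R" if "a \<in> R" "b \<in> R" for a b
    using that by (auto simp: R_def simp flip: to_fract_add to_fract_mult)
  have nat: "of_nat m \<in> R" for m
    by (simp add: R_def flip: to_fract_of_nat)
  have vars: "inner_var \<in> R" "1 - inner_var \<in> R" "outer_var \<in> R"
    by (auto simp: R_def inner_var_def outer_var_def simp flip: to_fract_1 to_fract_diff)
  define u where "u = sv_base inner_var"
  define h where "h = fps_const (1 - inner_var) + fps_const inner_var * u"
  have h: "fact m * h $ m \<in> R" if "fact m * u $ m \<in> R" for m
  proof (cases "m = 0")
    case True
    thus ?thesis using R vars nat[of 1] that by (simp add: h_def)
  next
    case False
    hence "fact m * h $ m = inner_var * (fact m * u $ m)" by (simp add: h_def)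
    thus ?thesis using R(2)[OF vars(1) that] by (simp only:)
  qed
  have u: "fact m * u $ m \<in> R" for m
  proof (induction m rule: less_induct)
    case (less m)
    show ?case
    proof (cases m)
      case 0
      thus ?thesis using nat[of 1] by (simp add: u_def sv_base_nth_0 inner_var_neq_1)
    next
      case (Suc n)
      have "fps_deriv u = fps_const 1 * u * h"
        using sv_base_deriv[OF inner_var_neq_1] by (simp add: u_def h_def)
      thus ?thesis unfolding Suc using R nat nat[of 1] less h Suc
        by (intro fact_fps_nth_Suc_in_subring[where y = 1 and h = h]) auto
    qed
  qed
  define G where "G = fps_pow u outer_var"
  have "fact m * G $ m \<in> R" for m
  proof (induction m rule: less_induct)
    case (less m)
    show ?case
    proof (cases m)
      case 0
      thus ?thesis using nat[of 1]
        by (simp add: G_def u_def fps_pow_nth_0 sv_base_nth_0 inner_var_neq_1)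
    next
      case (Suc n)
      have "fps_deriv G = fps_const outer_var * G * h"
        using sv_egf_deriv[OF inner_var_neq_1] by (simp add: G_def u_def h_def)
      thus ?thesis unfolding Suc using R nat vars less h u Suc
        by (intro fact_fps_nth_Suc_in_subring[where y = outer_var and h = h]) auto
    qed
  qed
  from this[of n] obtain F where F: "fact n * G $ n = to_fract F"
    unfolding R_def by (elim rangeE)
  show ?thesis
    unfolding savage_viswanathan_def G_def[unfolded u_def, symmetric] F to_fract_eq_iff
    by simp
qed


subsection \<open>The \<open>1/k\<close>-Eulerian polynomials\<close>

text \<open>Substitution \<open>F(x,b)\<close> of \<open>b\<close>, a rational function in \<open>x\<close> and \<open>k\<close>, for the
  outer indeterminate of \<open>F\<close>.\<close>

definition subst_outer ::
    "rat poly poly \<Rightarrow> rat poly poly fract \<Rightarrow> rat poly poly fract"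
  where "subst_outer F b = poly (map_poly (\<lambda>p. to_fract [:p:]) F) b"

definition eulerian_1_over_k :: "nat \<Rightarrow> rat poly poly fract"
  where "eulerian_1_over_k n =
    outer_var ^ n * subst_outer (savage_viswanathan n) (1 / outer_var)"


subsection \<open>Continued fractions\<close>

text \<open>\<open>cfrac_trunc a b n = a\<^sub>0 / (b\<^sub>0 - a\<^sub>1 / (b\<^sub>1 - \<dots> - a\<^sub>n / b\<^sub>n))\<close>\<close>

fun cfrac_trunc :: "(nat \<Rightarrow> 'a::field fps) \<Rightarrow> (nat \<Rightarrow> 'a fps) \<Rightarrow> nat \<Rightarrow> 'a fps"
  where
    "cfrac_trunc a b 0 = a 0 / b 0"
  | "cfrac_trunc a b (Suc n) =
       a 0 / (b 0 - cfrac_trunc (\<lambda>i. a (Suc i)) (\<lambda>i. b (Suc i)) n)"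

text \<open>The metric on \<^typ>\<open>'a fps\<close> is the \<open>z\<close>-adic one.\<close>

definition has_cfrac :: "'a::field fps \<Rightarrow> (nat \<Rightarrow> 'a fps) \<Rightarrow> (nat \<Rightarrow> 'a fps) \<Rightarrow> bool"
  where "has_cfrac f a b \<longleftrightarrow> cfrac_trunc a b \<longlonglongrightarrow> f"

end

(*
  Let u be the base series, V = u - 1, and let Q be the exponential generating function of
  F_n(x, 1/k). Since V' = (1 + V)(1 + x V) and k Q' = Q (1 + x V), the derivative of Q V^i is a
  combination of Q V^(i-1), Q V^i and Q V^(i+1). The formal Laplace transform, scaled by
  z^n -> k^n n! z^n, takes Q to the ordinary generating function of the 1/k-Eulerian polynomials
  and turns these equations into a three-term recurrence between the transforms L_i of Q V^i.
  The ratios L_(i+1) / L_i are, up to explicit factors, the tails of the J-fraction. With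
  R_i = L_(i+1) / L_i, the tails of the S-fraction are c_(2i+1) z (1 + x R_i) and
  x R_i / (1 + x R_i).
*)

theory Submission
  imports Defs
begin

section \<open>Convergence of a continued fraction with known tails\<close>

text \<open>If \<open>s\<close> and \<open>t\<close> are the truncations of the fraction and of its
  first tail, then \<open>s - T 0\<close> is \<open>a 0 * (t - T 1)\<close> divided by the units
  \<open>b 0 - t\<close> and \<open>b 0 - T 1\<close>. The error of \<open>t\<close> carries the
  factor \<open>a 1\<close>, which \<open>fps_X\<close> divides, so each level gains one power of
  \<open>fps_X\<close>. Keeping \<open>a 0\<close> in the divisor makes this gain available to the
  induction.\<close>

lemma cfrac_trunc_dvd_diff:
  fixes a b T :: "nat \<Rightarrow> 'a::field fps"
  assumes tails: "\<And>i. T i * (b i - T (Suc i)) = a i"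
    and b: "\<And>i. b i $ 0 = 1"
    and T: "\<And>i. T (Suc i) $ 0 = 0"
    and a: "\<And>i. a (Suc i) $ 0 = 0"
  shows "fps_X ^ n * a 0 dvd cfrac_trunc a b n - T 0"
  using assms
proof (induction n arbitrary: a b T)
  case 0
  have "b 0 $ 0 \<noteq> 0" using 0(2) by simp
  hence "cfrac_trunc a b 0 = a 0 * inverse (b 0)" by (simp add: fps_divide_unit)
  moreover have "T 0 = a 0 * inverse (b 0 - T (Suc 0))"
  proof -
    have "(b 0 - T (Suc 0)) $ 0 \<noteq> 0" using 0(2,3) by simp
    hence "(b 0 - T (Suc 0)) * inverse (b 0 - T (Suc 0)) = 1"
      by (rule inverse_mult_eq_1')
    thus ?thesis using 0(1)[of 0] by (metis mult.assoc mult_1_right)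
  qed
  ultimately show ?case by simp
next
  case (Suc n)
  define t where "t = cfrac_trunc (\<lambda>i. a (Suc i)) (\<lambda>i. b (Suc i)) n"
  have "fps_X ^ n * a (Suc 0) dvd t - T (Suc 0)"
    unfolding t_def by (rule Suc.IH[where T = "\<lambda>i. T (Suc i)"]) (use Suc.prems in auto)
  moreover have "fps_X dvd a (Suc 0)"
  proof (cases "a (Suc 0) = 0")
    case False
    thus ?thesis using Suc.prems(4)[of 0]
      by (subst fps_dvd_iff) (auto simp: Suc_le_eq subdegree_eq_0_iff zero_less_iff_neq_zero)
  qed simp
  hence "fps_X ^ Suc n dvd fps_X ^ n * a (Suc 0)"
    by (simp add: mult.commute[of fps_X] mult_dvd_mono)
  ultimately have X: "fps_X ^ Suc n dvd t - T (Suc 0)" by (rule dvd_trans[rotated])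
  \<comment> \<open>The error of \<open>t\<close> is divisible by \<open>fps_X\<close>, so
    \<open>t\<close> inherits the zero constant term of \<open>T (Suc 0)\<close> and both
    denominators have constant term 1.\<close>
  then obtain q where "t - T (Suc 0) = fps_X ^ Suc n * q" by (elim dvdE)
  hence "(t - T (Suc 0)) $ 0 = (fps_X ^ Suc n * q) $ 0" by (simp only:)
  hence "t $ 0 = T (Suc 0) $ 0" by simp
  hence D0: "(b 0 - t) $ 0 = 1" and E0: "(b 0 - T (Suc 0)) $ 0 = 1"
    using Suc.prems(2,3) by auto
  define s where "s = cfrac_trunc a b (Suc n)"
  have "s * (b 0 - t) = a 0"
    using D0 by (simp add: s_def t_def[symmetric] fps_divide_unit mult.assoc inverse_mult_eq_1)
  hence "(s - T 0) * ((b 0 - t) * (b 0 - T (Suc 0))) = a 0 * (t - T (Suc 0))"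
    using Suc.prems(1)[of 0] by (simp add: algebra_simps) algebra
  moreover have "fps_X ^ Suc n * a 0 dvd a 0 * (t - T (Suc 0))"
    using X by (metis mult.commute mult_dvd_mono dvd_refl)
  moreover have "((b 0 - t) * (b 0 - T (Suc 0))) dvd 1"
    using D0 E0 by simp
  ultimately show ?case unfolding s_def[symmetric]
    by (metis dvd_mult_unit_iff)
qed

text \<open>The coefficient of index \<open>n\<close> has its final value in every truncation of
  index above \<open>n\<close>. Both expansions thus reduce to exhibiting their tails.\<close>

lemma has_cfrac_if_tails:
  fixes a b T :: "nat \<Rightarrow> 'a::field fps"
  assumes "\<And>i. T i * (b i - T (Suc i)) = a i"
    and "\<And>i. b i $ 0 = 1"
    and "\<And>i. T (Suc i) $ 0 = 0"
    and "\<And>i. a (Suc i) $ 0 = 0"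
  shows "has_cfrac (T 0) a b"
  unfolding has_cfrac_def
proof (rule tendsto_fpsI)
  fix n
  show "\<forall>\<^sub>F m in sequentially. cfrac_trunc a b m $ n = T 0 $ n"
    using eventually_gt_at_top[of n]
  proof eventually_elim
    case (elim m)
    have "fps_X ^ m dvd cfrac_trunc a b m - T 0"
      using cfrac_trunc_dvd_diff[where T = T and b = b and a = a, OF assms] by (rule dvd_mult_left)
    then obtain q where "cfrac_trunc a b m - T 0 = fps_X ^ m * q" by (elim dvdE)
    hence "(cfrac_trunc a b m - T 0) $ n = 0"
      using elim by (simp add: fps_X_power_mult_nth)
    thus ?case by simp
  qed
qed

section \<open>The scaled formal Laplace transform\<close>

text \<open>Formally the integral of \<open>exp (- t) * f (k * z * t)\<close> over positive
  \<open>t\<close>. It takes the exponential generating function of \<open>s n\<close> to the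
  ordinary generating function of \<open>k ^ n * s n\<close>.\<close>

definition scaled_laplace :: "'a::field_char_0 \<Rightarrow> 'a fps \<Rightarrow> 'a fps"
  where "scaled_laplace k f = Abs_fps (\<lambda>n. k ^ n * fact n * f $ n)"

lemma scaled_laplace_nth [simp]: "scaled_laplace k f $ n = k ^ n * fact n * f $ n"
  by (simp add: scaled_laplace_def)

lemma scaled_laplace_add: "scaled_laplace k (f + g) = scaled_laplace k f + scaled_laplace k g"
  by (rule fps_ext) (simp add: algebra_simps)

lemma scaled_laplace_const_mult:
  "scaled_laplace k (fps_const c * f) = fps_const c * scaled_laplace k f"
  by (rule fps_ext) simp

text \<open>Integration by parts for the formal integral; it turns a differential equation into a
  linear relation between transforms.\<close>

lemma scaled_laplace_deriv:
  "scaled_laplace k f =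
     fps_const (f $ 0) + fps_X * scaled_laplace k (fps_const k * fps_deriv f)"
proof (rule fps_ext)
  fix n
  show "scaled_laplace k f $ n =
    (fps_const (f $ 0) + fps_X * scaled_laplace k (fps_const k * fps_deriv f)) $ n"
    by (cases n) (simp_all add: algebra_simps del: of_nat_Suc)
qed

lemma subdegree_scaled_laplace:
  assumes "k \<noteq> 0"
  shows "subdegree (scaled_laplace k f) = subdegree f"
proof (cases "f = 0")
  case False
  thus ?thesis using assms by (intro subdegreeI) auto
next
  case True
  hence "scaled_laplace k f = 0" by (intro fps_ext) simp
  thus ?thesis using True by simp
qed

section \<open>Three-term recurrence and ratios of the transforms\<close>

text \<open>The product rule gives \<open>i * V ^ (i - 1)\<close> times the quadratic
  \<open>(1 + V) * (1 + x * V)\<close> from \<open>V ^ i\<close>, and \<open>(1 + x * V) / k\<close>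
  from \<open>Q\<close>; the three coefficients are collected by powers of \<open>V\<close>.\<close>

lemma sheffer_deriv:
  fixes Q V :: "'a::field_char_0 fps"
  assumes k: "k \<noteq> 0"
    and Q: "fps_deriv Q = fps_const (1 / k) * Q * (1 + fps_const x * V)"
    and V: "fps_deriv V = (1 + V) * (1 + fps_const x * V)"
  shows "fps_const k * fps_deriv (Q * V ^ i) =
    fps_const (of_nat i * k) * (Q * V ^ (i - 1)) +
    fps_const (of_nat i * k * x + of_nat i * k + 1) * (Q * V ^ i) +
    fps_const (x * (of_nat i * k + 1)) * (Q * V ^ Suc i)"
proof -
  have kQ: "fps_const k * fps_deriv Q = Q * (1 + fps_const x * V)"
  proof -
    have "fps_const k * fps_const (1 / k) = (1 :: 'a fps)" using k by simp
    thus ?thesis unfolding Q by (metis mult.assoc mult_1_left)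
  qed
  have *: "fps_const k * fps_deriv (Q * V ^ i) =
      (fps_const k * fps_deriv Q) * V ^ i + fps_const k * Q * fps_deriv (V ^ i)"
    by (simp add: algebra_simps)
  show ?thesis
    unfolding * kQ fps_deriv_power V
    \<comment> \<open>For \<open>i = 0\<close> the truncated exponent \<open>i - 1\<close> is
      harmless, since its coefficient is zero.\<close>
    by (cases i) (simp_all add: algebra_simps flip: fps_const_add fps_const_mult)
qed

text \<open>With \<open>R i\<close> the quotient of consecutive transforms, this is the three-term
  recurrence divided by the transform of \<open>Q * V ^ i\<close>. Only index 0 has an inhomogeneous
  term, because \<open>V\<close> has zero constant term.\<close>

lemma sheffer_laplace_ratios:
  fixes Q V :: "'a::field_char_0 fps"
  assumes k: "k \<noteq> 0"
    and Q: "fps_deriv Q = fps_const (1 / k) * Q * (1 + fps_const x * V)"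
    and V: "fps_deriv V = (1 + V) * (1 + fps_const x * V)"
    and Q0: "Q $ 0 = 1" and V0: "V $ 0 = 0"
  obtains R where
    "\<And>i. R i $ 0 = 0"
    "scaled_laplace k Q * (1 - fps_X - fps_const x * fps_X * R 0) = 1"
    "\<And>i. R i * (1 - fps_const (of_nat (Suc i) * k * x + of_nat (Suc i) * k + 1) * fps_X -
        fps_const (x * (of_nat (Suc i) * k + 1)) * fps_X * R (Suc i)) =
      fps_const (of_nat (Suc i) * k) * fps_X"
proof -
  define L where "L i = scaled_laplace k (Q * V ^ i)" for i
  have L: "L i = fps_const ((Q * V ^ i) $ 0) + fps_X * (fps_const (of_nat i * k) * L (i - 1) +
      fps_const (of_nat i * k * x + of_nat i * k + 1) * L i +
      fps_const (x * (of_nat i * k + 1)) * L (Suc i))" for i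
    unfolding L_def
    by (subst scaled_laplace_deriv, subst sheffer_deriv[OF k Q V])
      (simp only: scaled_laplace_add scaled_laplace_const_mult)
  have "fps_deriv V $ 0 = 1" unfolding V using V0 by simp
  hence "V $ 1 = 1" by simp
  hence subV: "subdegree V = 1" using V0 by (intro subdegreeI) auto
  \<comment> \<open>The exact order \<open>i\<close> makes each transform divide the next one, so
    that \<open>R\<close> below is a true quotient, of order one.\<close>
  have subL: "subdegree (L i) = i" for i
  proof -
    have "Q \<noteq> 0" "V \<noteq> 0" using Q0 subV by auto
    moreover have "subdegree Q = 0" using Q0 by (simp add: subdegree_eq_0_iff)
    ultimately show ?thesis using subV by (simp add: L_def subdegree_scaled_laplace[OF k])
  qed
  have L00: "L 0 $ 0 = 1" by (simp add: L_def Q0)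
  \<comment> \<open>The zero series also has subdegree 0, so \<open>i = 0\<close> needs the constant
    term.\<close>
  have L_nz: "L i \<noteq> 0" for i
    using subL[of i] L00 by (cases "i = 0") auto
  define R where "R i = L (Suc i) / L i" for i
  have R: "R i * L i = L (Suc i)" for i
    unfolding R_def by (intro dvd_div_mult_self) (simp add: fps_dvd_iff L_nz subL)
  have ratio: "r * (1 - a * z - b * z * r') * l = c * z * l"
    if "r * l = z * (c * l + a * (r * l) + b * (r' * (r * l)))" for a b c l r r' z :: "'a fps"
    using that by (simp add: algebra_simps)
  show thesis
  proof
    show "R i $ 0 = 0" for i
    proof -
      have "R i \<noteq> 0" using R[of i] L_nz[of "Suc i"] by auto
      hence "subdegree (R i) + i = Suc i"
        using arg_cong[OF R[of i], of subdegree] by (simp add: L_nz subL)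
      thus ?thesis by (intro nth_less_subdegree_zero) simp
    qed
    show "scaled_laplace k Q * (1 - fps_X - fps_const x * fps_X * R 0) = 1"
    proof -
      have "L 0 = 1 + fps_X * (L 0 + fps_const x * L (Suc 0))"
        using L[of 0] by (simp add: Q0)
      thus ?thesis unfolding R[of 0, symmetric] by (simp add: L_def algebra_simps)
    qed
    show "R i * (1 - fps_const (of_nat (Suc i) * k * x + of_nat (Suc i) * k + 1) * fps_X -
        fps_const (x * (of_nat (Suc i) * k + 1)) * fps_X * R (Suc i)) =
      fps_const (of_nat (Suc i) * k) * fps_X" (is "R i * (1 - ?a * _ - ?b * _ * _) = ?c * _") for i
    proof -
      have "L (Suc i) = fps_X * (?c * L i + ?a * L (Suc i) + ?b * L (Suc (Suc i)))"
        using L[of "Suc i"] V0 by simp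
      hence "R i * (1 - ?a * fps_X - ?b * fps_X * R (Suc i)) * L i = ?c * fps_X * L i"
        unfolding R[of "Suc i", symmetric] R[of i, symmetric] by (rule ratio)
      thus ?thesis using L_nz[of i] by (simp only: mult_cancel_right) simp
    qed
  qed
qed

section \<open>The J-fraction and the S-fraction of the transform\<close>

lemma jfrac_sheffer_laplace:
  fixes Q V :: "'a::field_char_0 fps"
  assumes "k \<noteq> 0"
    and "fps_deriv Q = fps_const (1 / k) * Q * (1 + fps_const x * V)"
    and "fps_deriv V = (1 + V) * (1 + fps_const x * V)"
    and "Q $ 0 = 1" and "V $ 0 = 0"
    and \<alpha>: "\<And>i. \<alpha> i = of_nat i * k * x + of_nat i * k + 1"
    and \<beta>: "\<And>i. i \<ge> 1 \<Longrightarrow> \<beta> i = of_nat i * k * x * (of_nat (i - 1) * k + 1)"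
  shows "has_cfrac (scaled_laplace k Q)
    (\<lambda>i. if i = 0 then 1 else fps_const (\<beta> i) * fps_X ^ 2)
    (\<lambda>i. 1 - fps_const (\<alpha> i) * fps_X)"
proof -
  obtain R where R0: "\<And>i. R i $ 0 = 0"
    and base: "scaled_laplace k Q * (1 - fps_X - fps_const x * fps_X * R 0) = 1"
    and step: "\<And>i. R i * (1 - fps_const (of_nat (Suc i) * k * x + of_nat (Suc i) * k + 1) * fps_X -
        fps_const (x * (of_nat (Suc i) * k + 1)) * fps_X * R (Suc i)) =
      fps_const (of_nat (Suc i) * k) * fps_X"
    using sheffer_laplace_ratios[OF assms(1-5)] by blast
  \<comment> \<open>The tail is \<open>R j\<close> together with the factor that accompanies it in
    the preceding relation; that factor times the right-hand side of the relation for
    \<open>R j\<close> is the partial numerator.\<close>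
  define T where "T i = (case i of 0 \<Rightarrow> scaled_laplace k Q
    | Suc j \<Rightarrow> fps_const (x * (of_nat j * k + 1)) * fps_X * R j)" for i
  have "has_cfrac (T 0) (\<lambda>i. if i = 0 then 1 else fps_const (\<beta> i) * fps_X ^ 2)
    (\<lambda>i. 1 - fps_const (\<alpha> i) * fps_X)"
  proof (rule has_cfrac_if_tails)
    fix i
    show "T i * (1 - fps_const (\<alpha> i) * fps_X - T (Suc i)) =
        (if i = 0 then 1 else fps_const (\<beta> i) * fps_X ^ 2)"
    proof (cases i)
      case 0
      thus ?thesis using base by (simp add: T_def \<alpha>)
    next
      case (Suc j)
      have "T i * (1 - fps_const (\<alpha> i) * fps_X - T (Suc i)) =
          fps_const (x * (of_nat j * k + 1)) * fps_X * (fps_const (of_nat (Suc j) * k) * fps_X)"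
        unfolding step[of j, symmetric] by (simp only: Suc T_def \<alpha> nat.case mult.assoc)
      also have "\<dots> = fps_const (x * (of_nat j * k + 1) * (of_nat (Suc j) * k)) * fps_X ^ 2"
        by (simp only: power2_eq_square mult_ac flip: fps_const_mult)
      also have "x * (of_nat j * k + 1) * (of_nat (Suc j) * k) = \<beta> i"
        by (simp add: Suc \<beta>)
      finally show ?thesis using Suc by simp
    qed
  qed (auto simp: T_def)
  thus ?thesis by (simp add: T_def)
qed

text \<open>Each relation between \<open>R j\<close> and \<open>R (Suc j)\<close> splits into two
  levels by way of \<open>P j = 1 + x * R j\<close>.\<close>

lemma sfrac_sheffer_laplace:
  fixes Q V :: "'a::field_char_0 fps"
  assumes "k \<noteq> 0"
    and "fps_deriv Q = fps_const (1 / k) * Q * (1 + fps_const x * V)"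
    and "fps_deriv V = (1 + V) * (1 + fps_const x * V)"
    and "Q $ 0 = 1" and "V $ 0 = 0"
    and c_odd: "\<And>i. i \<ge> 1 \<Longrightarrow> c (2 * i - 1) = of_nat (i - 1) * k + 1"
    and c_even: "\<And>i. i \<ge> 1 \<Longrightarrow> c (2 * i) = of_nat i * k * x"
  shows "has_cfrac (scaled_laplace k Q)
    (\<lambda>i. if i = 0 then 1 else fps_const (c i) * fps_X) (\<lambda>i. 1)"
proof -
  obtain R where R0: "\<And>i. R i $ 0 = 0"
    and base: "scaled_laplace k Q * (1 - fps_X - fps_const x * fps_X * R 0) = 1"
    and step: "\<And>i. R i * (1 - fps_const (of_nat (Suc i) * k * x + of_nat (Suc i) * k + 1) * fps_X -
        fps_const (x * (of_nat (Suc i) * k + 1)) * fps_X * R (Suc i)) =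
      fps_const (of_nat (Suc i) * k) * fps_X"
    using sheffer_laplace_ratios[OF assms(1-5)] by blast
  define P where "P i = 1 + fps_const x * R i" for i
  have P: "P i * inverse (P i) = 1" for i
    by (intro inverse_mult_eq_1') (simp add: P_def R0)
  \<comment> \<open>For \<open>i = 2 * j + 1\<close> the index \<open>i div 2\<close> is
    \<open>j\<close>; for \<open>i = 2 * j + 2\<close> it is one too large.\<close>
  define T where "T i = (if i = 0 then scaled_laplace k Q
    else if odd i then fps_const (of_nat (i div 2) * k + 1) * fps_X * P (i div 2)
    else fps_const x * R (i div 2 - 1) * inverse (P (i div 2 - 1)))" for i
  have "has_cfrac (T 0) (\<lambda>i. if i = 0 then 1 else fps_const (c i) * fps_X) (\<lambda>i. 1)"
  proof (rule has_cfrac_if_tails)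
    fix i :: nat
    consider (zero) "i = 0" | (odd) j where "i = 2 * j + 1" | (even) j where "i = 2 * j + 2"
    proof (cases "even i")
      case True
      then obtain m where "i = 2 * m" by (elim evenE)
      thus thesis using zero even[of "m - 1"] by (cases m) auto
    next
      case False
      thus thesis using odd by (elim oddE)
    qed
    thus "T i * (1 - T (Suc i)) = (if i = 0 then 1 else fps_const (c i) * fps_X)"
    proof cases
      case zero
      thus ?thesis using base by (simp add: T_def P_def algebra_simps)
    next
      case odd
      \<comment> \<open>This is \<open>P j - x * R j = 1\<close>.\<close>
      have "P j * (1 - fps_const x * R j * inverse (P j)) = 1"
        using P[of j] by (simp add: P_def algebra_simps)
      moreover have "c i = of_nat j * k + 1" using c_odd[of "Suc j"] odd by simp
      ultimately show ?thesis
        by (simp add: T_def odd mult.assoc)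
    next
      case even
      let ?j = "of_nat (Suc j) :: 'a"
      let ?d = "1 - fps_const (?j * k + 1) * fps_X * P (Suc j)"
      have "T i * (1 - T (Suc i)) = fps_const x * (R j * ?d) * inverse (P j)"
        by (simp add: T_def even mult_ac del: of_nat_Suc)
      \<comment> \<open>Moving the term with coefficient \<open>?j * k * x\<close> to the right-hand
        side of \<open>step\<close> produces \<open>P j\<close> there and leaves
        \<open>P (Suc j)\<close> on the left.\<close>
      also have "R j * ?d = fps_const (?j * k) * fps_X * P j"
        using step[of j] unfolding P_def
        by (simp only: algebra_simps mult_1_left fps_const_1_eq_1 mult_1_right
            flip: fps_const_mult fps_const_add)
      also have "fps_const x * (fps_const (?j * k) * fps_X * P j) * inverse (P j) =
          fps_const x * fps_const (?j * k) * fps_X * (P j * inverse (P j))"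
        by (simp only: mult.assoc)
      also have "\<dots> = fps_const (?j * k * x) * fps_X"
        unfolding P by (simp add: mult_ac del: of_nat_Suc)
      also have "?j * k * x = c i" using c_even[of "Suc j"] even by simp
      finally show ?thesis using even by simp
    qed
  qed (auto simp: T_def R0)
  thus ?thesis by (simp add: T_def)
qed

section \<open>Specializing the Savage-Viswanathan generating function in \<open>y\<close>\<close>

text \<open>Products of exponential generating functions are binomial convolutions. This form of the
  equation is free of division, so it can be moved between the fraction field and the polynomial
  ring.\<close>

lemma fps_deriv_eq_const_mult_iff_fact_nth:
  fixes f h :: "'a::field_char_0 fps"
  shows "fps_deriv f = fps_const c * f * h \<longleftrightarrow> (\<forall>n. fact (Suc n) * f $ Suc n =
    c * (\<Sum>i=0..n. of_nat (n choose i) * ((fact i * f $ i) * (fact (n - i) * h $ (n - i)))))"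
proof -
  have "fps_deriv f $ n = (fps_const c * f * h) $ n \<longleftrightarrow> fact (Suc n) * f $ Suc n =
    c * (\<Sum>i=0..n. of_nat (n choose i) * ((fact i * f $ i) * (fact (n - i) * h $ (n - i))))" for n
  proof -
    have "(\<Sum>i=0..n. of_nat (n choose i) * ((fact i * f $ i) * (fact (n - i) * h $ (n - i)))) =
        (\<Sum>i=0..n. fact n * (f $ i * h $ (n - i)))"
      by (intro sum.cong) (auto simp: binomial_fact field_simps)
    also have "\<dots> = fact n * (f * h) $ n"
      by (simp add: fps_mult_nth sum_distrib_left)
    finally have "(fact (Suc n) * f $ Suc n = c * (\<Sum>i=0..n. of_nat (n choose i) *
        ((fact i * f $ i) * (fact (n - i) * h $ (n - i))))) \<longleftrightarrow>
        fact n * (of_nat (Suc n) * f $ Suc n) = fact n * (c * (f * h) $ n)"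
      by (simp add: fact_Suc mult_ac del: of_nat_Suc)
    also have "\<dots> \<longleftrightarrow> fps_deriv f $ n = (fps_const c * f * h) $ n"
      by (simp add: mult.assoc del: of_nat_Suc)
    finally show ?thesis by simp
  qed
  thus ?thesis unfolding fps_eq_iff by simp
qed

lemma subst_outer_pCons: "subst_outer (pCons a p) b = to_fract [:a:] + b * subst_outer p b"
  by (simp add: subst_outer_def map_poly_pCons)

lemma subst_outer_0 [simp]: "subst_outer 0 b = 0"
  by (simp add: subst_outer_def)

lemma subst_outer_add: "subst_outer (p + q) b = subst_outer p b + subst_outer q b"
proof (induction p q rule: poly_induct2)
  case (pCons a p a' q)
  have "to_fract [:a + a':] = to_fract [:a:] + to_fract [:a':]"
    by (simp flip: to_fract_add)
  thus ?case using pCons by (simp add: subst_outer_pCons algebra_simps)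
qed simp

lemma subst_outer_smult: "subst_outer (smult a p) b = to_fract [:a:] * subst_outer p b"
proof (induction p)
  case (pCons a' p)
  have "to_fract [:a * a':] = to_fract [:a:] * to_fract [:a':]"
    by (simp flip: to_fract_mult)
  thus ?case using pCons by (simp add: subst_outer_pCons algebra_simps)
qed simp

lemma subst_outer_mult: "subst_outer (p * q) b = subst_outer p b * subst_outer q b"
proof (induction p)
  case (pCons a p)
  thus ?case
    by (simp add: subst_outer_pCons subst_outer_add subst_outer_smult algebra_simps)
qed simp

lemma subst_outer_const [simp]: "subst_outer [:p:] b = to_fract [:p:]"
  by (simp add: subst_outer_pCons)

lemma subst_outer_1 [simp]: "subst_outer 1 b = 1"
  by (simp add: one_pCons flip: to_fract_1)

lemma subst_outer_of_nat: "subst_outer (of_nat n) b = of_nat n"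
  by (induction n) (simp_all add: subst_outer_add)

lemma subst_outer_sum: "subst_outer (sum f A) b = (\<Sum>i\<in>A. subst_outer (f i) b)"
  by (induction A rule: infinite_finite_induct) (simp_all add: subst_outer_add)

lemma to_fract_sum: "to_fract (sum f A) = (\<Sum>i\<in>A. to_fract (f i))"
  by (induction A rule: infinite_finite_induct) simp_all

text \<open>The coefficients of the base series do not involve \<open>y\<close>, so substituting for \<open>y\<close>
  leaves them unchanged.\<close>

lemma fact_sv_base_logderiv_nth_in_range:
  "\<exists>p. fact n * (fps_const (1 - inner_var) + fps_const inner_var * sv_base inner_var) $ n =
     to_fract [:p:]"
proof -
  define R where "R = range (\<lambda>p::rat poly. to_fract [:p:])"
  have RI: "a \<in> R" if "a = to_fract [:p:]" for a p
    using that by (auto simp: R_def)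
  have R: "a + b \<in> R" "a * b \<in> R" if "a \<in> R" "b \<in> R" for a b
    using that by (auto simp: R_def simp flip: to_fract_add to_fract_mult)
  have nat: "of_nat m \<in> R" for m
    by (rule RI[of _ "of_nat m"]) (simp add: of_nat_poly flip: to_fract_of_nat)
  have vars: "inner_var \<in> R" "1 - inner_var \<in> R"
    by (auto intro: RI[of _ "[:0, 1:]"] RI[of _ "[:1, -1:]"]
        simp: inner_var_def one_pCons simp flip: to_fract_1 to_fract_diff)
  define u where "u = sv_base inner_var"
  define h where "h = fps_const (1 - inner_var) + fps_const inner_var * u"
  have h: "fact m * h $ m \<in> R" if "fact m * u $ m \<in> R" for m
  proof (cases "m = 0")
    case True
    thus ?thesis using R vars that by (simp add: h_def)
  next
    case False
    hence "fact m * h $ m = inner_var * (fact m * u $ m)" by (simp add: h_def)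
    thus ?thesis using R(2)[OF vars(1) that] by (simp only:)
  qed
  \<comment> \<open>Since \<open>u' = u * h\<close> with \<open>h\<close> affine in
    \<open>u\<close>, each coefficient of \<open>u\<close> comes from earlier ones without leaving
    the polynomials in \<open>x\<close>.\<close>
  have "fact n * u $ n \<in> R"
  proof (induction n rule: less_induct)
    case (less n)
    show ?case
    proof (cases n)
      case 0
      thus ?thesis using nat[of 1] by (simp add: u_def sv_base_nth_0 inner_var_neq_1)
    next
      case (Suc m)
      have "fps_deriv u = fps_const 1 * u * h"
        using sv_base_deriv[OF inner_var_neq_1] by (simp add: u_def h_def)
      thus ?thesis unfolding Suc using R nat nat[of 1] less h Suc
        by (intro fact_fps_nth_Suc_in_subring[where y = 1 and h = h]) auto
    qed
  qed
  hence "fact n * h $ n \<in> R" by (rule h)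
  thus ?thesis by (auto simp: R_def h_def u_def)
qed

text \<open>Substitution is defined on polynomials only, so the differential equation is first read
  as a recurrence for the polynomials \<open>savage_viswanathan n\<close>, then evaluated at
  \<open>b\<close>, then read as a differential equation again.\<close>

lemma subst_outer_egf_deriv:
  defines "Q \<equiv> \<lambda>b. Abs_fps (\<lambda>n. subst_outer (savage_viswanathan n) b / fact n)"
  shows "fps_deriv (Q b) = fps_const b * Q b *
    (fps_const (1 - inner_var) + fps_const inner_var * sv_base inner_var)"
proof -
  define h where "h = fps_const (1 - inner_var) + fps_const inner_var * sv_base inner_var"
  have "\<exists>p. fact n * h $ n = to_fract [:p:]" for n
    unfolding h_def by (rule fact_sv_base_logderiv_nth_in_range)
  then obtain H where H: "\<And>n. fact n * h $ n = to_fract [:H n:]" by metis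
  let ?F = savage_viswanathan
  define G where "G = fps_pow (sv_base inner_var) outer_var"
  have G: "fact n * G $ n = to_fract (?F n)" for n
    unfolding G_def by (rule savage_viswanathan_egf[symmetric])
  have "fps_deriv G = fps_const outer_var * G * h"
    unfolding G_def h_def by (rule sv_egf_deriv[OF inner_var_neq_1])
  hence "fact (Suc n) * G $ Suc n = outer_var *
      (\<Sum>i=0..n. of_nat (n choose i) * ((fact i * G $ i) * (fact (n - i) * h $ (n - i))))" for n
    unfolding fps_deriv_eq_const_mult_iff_fact_nth by blast
  hence "to_fract (?F (Suc n)) = to_fract ([:0, 1:] *
      (\<Sum>i=0..n. of_nat (n choose i) * (?F i * [:H (n - i):])))" for n
    by (simp only: G H to_fract_sum to_fract_mult to_fract_of_nat outer_var_def)
  \<comment> \<open>Injectivity of \<open>to_fract\<close> brings the recurrence down to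
    polynomials, where the outer variable can be replaced by \<open>b\<close>.\<close>
  hence "?F (Suc n) = [:0, 1:] *
      (\<Sum>i=0..n. of_nat (n choose i) * (?F i * [:H (n - i):]))" for n
    by (simp only: to_fract_eq_iff)
  moreover have "subst_outer [:0, 1:] b = b" by (simp add: subst_outer_pCons flip: one_pCons)
  ultimately have "subst_outer (?F (Suc n)) b = b *
      (\<Sum>i=0..n. of_nat (n choose i) * (subst_outer (?F i) b * to_fract [:H (n - i):]))" for n
    by (simp only: subst_outer_sum subst_outer_mult subst_outer_of_nat subst_outer_const)
  hence "fps_deriv (Q b) = fps_const b * Q b * h"
    unfolding fps_deriv_eq_const_mult_iff_fact_nth H
    by (simp add: Q_def del: fact_Suc)
  thus ?thesis by (simp only: h_def)
qed

theorem corollary3: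
  fixes x k :: "rat poly poly fract" and c \<alpha> \<beta> :: "nat \<Rightarrow> rat poly poly fract"
  assumes x: "x = inner_var" and k: "k = outer_var"
    and c_odd: "\<And>i. i \<ge> 1 \<Longrightarrow> c (2 * i - 1) = of_nat (i - 1) * k + 1"
    and c_even: "\<And>i. i \<ge> 1 \<Longrightarrow> c (2 * i) = of_nat i * k * x"
    and \<alpha>: "\<And>i. \<alpha> i = of_nat i * k * x + of_nat i * k + 1"
    and \<beta>: "\<And>i. i \<ge> 1 \<Longrightarrow> \<beta> i = of_nat i * k * x * (of_nat (i - 1) * k + 1)"
  shows "has_cfrac (Abs_fps eulerian_1_over_k)
           (\<lambda>i. if i = 0 then 1 else fps_const (c i) * fps_X)
           (\<lambda>i. 1)
       \<and> has_cfrac (Abs_fps eulerian_1_over_k)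
           (\<lambda>i. if i = 0 then 1 else fps_const (\<beta> i) * fps_X ^ 2)
           (\<lambda>i. 1 - fps_const (\<alpha> i) * fps_X)"
proof -
  define Q where "Q = Abs_fps (\<lambda>n. subst_outer (savage_viswanathan n) (1 / k) / fact n)"
  define V where "V = sv_base x - 1"
  have k0: "k \<noteq> 0" by (simp add: k outer_var_def)
  have u0: "sv_base x $ 0 = 1" unfolding x by (intro sv_base_nth_0 inner_var_neq_1)
  have h: "fps_const (1 - inner_var) + fps_const inner_var * sv_base inner_var =
      1 + fps_const x * V"
    by (simp add: V_def x algebra_simps flip: fps_const_sub)
  have Q': "fps_deriv Q = fps_const (1 / k) * Q * (1 + fps_const x * V)"
    using subst_outer_egf_deriv[of "1 / k"] unfolding h Q_def .
  have V': "fps_deriv V = (1 + V) * (1 + fps_const x * V)"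
    using sv_base_deriv[OF inner_var_neq_1] unfolding h by (simp add: V_def x)
  have "to_fract (savage_viswanathan 0) = 1"
    unfolding savage_viswanathan_egf using u0 by (simp add: fps_pow_nth_0 x)
  hence "savage_viswanathan 0 = 1"
    by (metis to_fract_1 to_fract_eq_iff)
  hence Q0: "Q $ 0 = 1" by (simp add: Q_def)
  have V0: "V $ 0 = 0" by (simp add: V_def u0)
  \<comment> \<open>The weight \<open>k ^ n * fact n\<close> cancels the factorial in
    \<open>Q\<close> and supplies the power of \<open>k\<close> in the \<open>1/k\<close>-Eulerian
    polynomial.\<close>
  have "Abs_fps eulerian_1_over_k = scaled_laplace k Q"
    by (rule fps_ext) (simp add: Q_def eulerian_1_over_k_def k)
  thus ?thesis
    using sfrac_sheffer_laplace[OF k0 Q' V' Q0 V0 c_odd c_even]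
      jfrac_sheffer_laplace[OF k0 Q' V' Q0 V0 \<alpha> \<beta>] by simp
qed

end
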